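(* Let $R=K[x_1, \ldots, x_n]$ with $n\geq 3$ be a polynomial ring in $n$ variables with coefficients in a field $K$. Then there exist infinitely many monomial ideals in $R$ that have the phenomenon of fluctuation in associated primes of powers.
   Context: $\mathrm{Ass}(R/I)$ is the set of associated primes of $I$, i.e. primes of the form $(I:v)$ with $v\in R$. A monomial ideal $I\subset R=K[x_1,\ldots,x_n]$ has the phenomenon of fluctuation in associated primes of powers if there exist a monomial prime ideal $\mathfrak{p}$ in $R$ (an ideal generated by a set of variables) and positive integers $a<b<c$ satisfying at least one of the following: (i) $\mathfrak{p} \in \mathrm{Ass}(R/I^a)$, $\mathfrak{p} \notin \mathrm{Ass}(R/I^b)$, and $\mathfrak{p} \in \mathrm{Ass}(R/I^c)$; (ii) $\mathfrak{p} \notin \mathrm{Ass}(R/I^a)$, $\mathfrak{p} \in \mathrm{Ass}(R/I^b)$, and $\mathfrak{p} \notin \mathrm{Ass}(R/I^c)$. *)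

theory Defs
  imports
    "HOL-Library.Poly_Mapping"
    "HOL-Algebra.Ideal_Product"
    "HOL-Algebra.Algebraic_Closure_Type"
begin

text \<open>
  The polynomial ring over a field \<open>'k\<close> in \<open>CARD('n)\<close> variables: finitely supported maps from
  exponent vectors to coefficients, with the convolution product of
  \<^theory>\<open>HOL-Library.Poly_Mapping\<close>, viewed as a HOL-Algebra ring.
\<close>

type_synonym ('n, 'k) mpoly = "('n \<Rightarrow>\<^sub>0 nat) \<Rightarrow>\<^sub>0 'k"

abbreviation mpoly_ring :: "('n::finite, 'k::field) mpoly ring"
  where "mpoly_ring \<equiv> ring_of_type_algebra"

definition monomial :: "('n::finite \<Rightarrow>\<^sub>0 nat) \<Rightarrow> ('n, 'k::field) mpoly"
  where "monomial m = Poly_Mapping.single m 1"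

definition variable :: "'n::finite \<Rightarrow> ('n, 'k::field) mpoly"
  where "variable i = monomial (Poly_Mapping.single i 1)"

definition monomial_ideal :: "('n::finite, 'k::field) mpoly set \<Rightarrow> bool"
  where "monomial_ideal I \<longleftrightarrow> (\<exists>M. I = Idl\<^bsub>mpoly_ring\<^esub> (monomial ` M))"

text \<open>
  Taking \<open>V = {}\<close> gives the zero ideal, which also counts as a monomial prime.
\<close>

definition monomial_prime :: "('n::finite, 'k::field) mpoly set \<Rightarrow> bool"
  where "monomial_prime P \<longleftrightarrow> (\<exists>V. P = Idl\<^bsub>mpoly_ring\<^esub> (variable ` V))"

definition colon :: "('a, 'b) ring_scheme \<Rightarrow> 'a set \<Rightarrow> 'a \<Rightarrow> 'a set"
  where "colon R I v = {r \<in> carrier R. r \<otimes>\<^bsub>R\<^esub> v \<in> I}"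

text \<open>\<open>Ass(R/I)\<close>, as a set of ideals of \<open>R\<close>.\<close>

definition Ass :: "('a, 'b) ring_scheme \<Rightarrow> 'a set \<Rightarrow> 'a set set"
  where "Ass R I = {P. primeideal P R \<and> (\<exists>v \<in> carrier R. P = colon R I v)}"

text \<open>Powers taken in \<^const>\<open>ideals_set\<close> are the usual powers of an ideal.\<close>

abbreviation ideal_pow :: "('n::finite, 'k::field) mpoly set \<Rightarrow> nat \<Rightarrow> ('n, 'k) mpoly set"
  where "ideal_pow I k \<equiv> I [^]\<^bsub>ideals_set mpoly_ring\<^esub> k"

definition has_fluctuation :: "('n::finite, 'k::field) mpoly set \<Rightarrow> bool"
  where "has_fluctuation I \<longleftrightarrow>
    (\<exists>P a b c. monomial_prime P \<and> 0 < a \<and> a < b \<and> b < c \<and>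
      (P \<in> Ass mpoly_ring (ideal_pow I a) \<and>
       P \<notin> Ass mpoly_ring (ideal_pow I b) \<and>
       P \<in> Ass mpoly_ring (ideal_pow I c) \<or>
       P \<notin> Ass mpoly_ring (ideal_pow I a) \<and>
       P \<in> Ass mpoly_ring (ideal_pow I b) \<and>
       P \<notin> Ass mpoly_ring (ideal_pow I c)))"

end

theory Submission
  imports Defs
begin

text \<open>
  Pick three distinct variables \<open>x\<close>, \<open>y\<close>, \<open>z\<close> and, for \<open>t > 0\<close>, let
  \<open>I = (y^6, x y^5, x^4 y^2, x^5 y, x^6 z^t)\<close> and \<open>P = (x, y, z)\<close>. Then \<open>P\<close> is associated to
  \<open>I^2\<close>, but neither to \<open>I\<close> nor to \<open>I^3\<close>.

  Every generator has degree 6 in \<open>x\<close> and \<open>y\<close>, so the part of \<open>I^k\<close> free of \<open>z\<close> is encoded by the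
  set of \<open>x\<close>-exponents of its generators, which is the \<open>k\<close>-fold sumset of \<open>A = {0, 1, 4, 5}\<close>;
  multiplying by a high power of \<open>z\<close> adds further exponents by means of \<open>6\<close>. The prime \<open>P\<close> is
  associated exactly when such an added exponent falls into a gap of what was there before: then
  some monomial in this gap lies outside \<open>I^k\<close>, while one more factor \<open>x\<close>, \<open>y\<close> or \<open>z\<close> moves it
  inside.
  For \<open>k = 1\<close> the added \<open>6\<close> lies beyond \<open>5 = Max A\<close>, so it fills no gap.
  For \<open>k = 2\<close> the sumset \<open>A + A = {0, 1, 2, 4, 5, 6, 8, 9, 10}\<close> has the gap \<open>7 = 6 + 1\<close>, and the
  witness is \<open>x^7 y^5 z^(t-1)\<close>.
  For \<open>k = 3\<close> there is no gap left, because \<open>A + A + A\<close> is the whole interval from 0 to 15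
  (\<open>sum_of_three_0145\<close>) and the added 16, 17, 18 extend it one by one; therefore \<open>I^3\<close> is cut out
  by two inequalities (\<open>power_contains_gens_3\<close>) and has no such corner.

  Passing from ideals to exponents rests on three facts: a polynomial lies in a monomial ideal iff
  all its terms do, so that powers of monomial ideals become sums of exponents
  (\<open>ideal_pow_monomials\<close>); an exponent \<open>u\<close> for which \<open>u + w\<close> lies in the exponent set \<open>E\<close> of the
  ideal exactly when \<open>w\<close> involves a variable from \<open>V\<close> makes \<open>(V)\<close> an associated prime
  (\<open>var_ideal_in_Ass\<close>); and conversely an associated prime \<open>(V)\<close>
  yields an exponent outside \<open>E\<close> with all its \<open>V\<close>-neighbours inside
  (\<open>var_ideal_in_Ass_imp_corner\<close>). Finally, \<open>x^6 z^s\<close> lies in \<open>I\<close> iff \<open>t \<le> s\<close>, so different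
  values of \<open>t\<close> give different ideals.
\<close>

section \<open>Monomial ideals as sets of exponents\<close>

text \<open>
  For upward closed \<open>E\<close> these are the monomial ideals, each determined by the exponents that
  occur in it.
\<close>

definition supported :: "('n::finite \<Rightarrow>\<^sub>0 nat) set \<Rightarrow> ('n, 'k::field) mpoly set"
  where "supported E = {f. Poly_Mapping.keys f \<subseteq> E}"

definition upward_closed :: "('n::finite \<Rightarrow>\<^sub>0 nat) set \<Rightarrow> bool"
  where "upward_closed E \<longleftrightarrow> (\<forall>e \<in> E. \<forall>w. e + w \<in> E)"

text \<open>
  The exponents of the monomials in the \<open>k\<close>-th power of the ideal generated by \<open>A\<close>. Starting from
  \<^const>\<open>UNIV\<close> at \<open>k = 0\<close>, the exponents of the unit ideal, makes every level upward closed
  without a separate closure step.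
\<close>

fun power_exps :: "('n::finite \<Rightarrow>\<^sub>0 nat) set \<Rightarrow> nat \<Rightarrow> ('n \<Rightarrow>\<^sub>0 nat) set"
  where
    "power_exps A 0 = UNIV"
  | "power_exps A (Suc k) = {e + a |e a. e \<in> power_exps A k \<and> a \<in> A}"

lemma upward_closed_power_exps: "upward_closed (power_exps A k)"
proof (induction k)
  case 0
  show ?case by (simp add: upward_closed_def)
next
  case (Suc k)
  show ?case
    unfolding upward_closed_def
  proof (intro ballI allI)
    fix e w :: "'a \<Rightarrow>\<^sub>0 nat"
    assume "e \<in> power_exps A (Suc k)"
    then obtain d a where "e = d + a" "d \<in> power_exps A k" "a \<in> A" by auto
    moreover from this have "d + w \<in> power_exps A k"
      using Suc by (simp add: upward_closed_def)
    moreover have "d + a + w = (d + w) + a" by (simp add: add_ac)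
    ultimately show "e + w \<in> power_exps A (Suc k)" by auto
  qed
qed

lemma mpoly_ring_simps [simp]:
  "carrier mpoly_ring = UNIV"
  "x \<otimes>\<^bsub>mpoly_ring\<^esub> y = x * y"
  "x \<oplus>\<^bsub>mpoly_ring\<^esub> y = x + y"
  "\<zero>\<^bsub>mpoly_ring\<^esub> = 0"
  "\<one>\<^bsub>mpoly_ring\<^esub> = 1"
  by (simp_all add: ring_of_type_algebra_def)

interpretation mpoly: cring "mpoly_ring :: ('n::finite, 'k::field) mpoly ring"
  by (rule cring_from_type_algebra)

lemma ideal_mpoly_ringI:
  fixes J :: "('n::finite, 'k::field) mpoly set"
  assumes "0 \<in> J" "\<And>f g. f \<in> J \<Longrightarrow> g \<in> J \<Longrightarrow> f + g \<in> J" "\<And>f g. f \<in> J \<Longrightarrow> g * f \<in> J"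
  shows "ideal J mpoly_ring"
proof (rule idealI)
  show "ring (mpoly_ring :: ('n, 'k) mpoly ring)" by (rule mpoly.ring_axioms)
  show "subgroup J (add_monoid mpoly_ring)"
  proof (rule mpoly.add.subgroupI)
    fix f assume "f \<in> J"
    have "\<ominus>\<^bsub>mpoly_ring\<^esub> f = (- 1) * f"
      using mpoly.l_neg[of f] by (simp add: eq_neg_iff_add_eq_0)
    then show "\<ominus>\<^bsub>mpoly_ring\<^esub> f \<in> J" using assms(3)[OF \<open>f \<in> J\<close>] by metis
  qed (use assms in auto)
qed (use assms in \<open>auto simp: mult.commute\<close>)

lemma ideal_supported:
  assumes "upward_closed E"
  shows "ideal (supported E :: ('n::finite, 'k::field) mpoly set) mpoly_ring"
proof (rule ideal_mpoly_ringI)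
  fix f g :: "('n, 'k) mpoly"
  assume f: "f \<in> supported E"
  show "f + g \<in> supported E" if "g \<in> supported E"
    using f that Poly_Mapping.keys_add[of f g] by (auto simp: supported_def)
  show "g * f \<in> supported E"
    using f assms keys_mult[of g f]
    by (fastforce simp: supported_def upward_closed_def add.commute)
qed (simp add: supported_def)

lemma single_in_supported_iff [simp]:
  "Poly_Mapping.single e c \<in> supported E \<longleftrightarrow> c = 0 \<or> e \<in> E"
  by (auto simp: supported_def)

lemma mpoly_eq_sum_singles:
  fixes f :: "('n::finite, 'k::field) mpoly"
  shows "f = (\<Sum>e \<in> Poly_Mapping.keys f. Poly_Mapping.single e (Poly_Mapping.lookup f e))"
  by (rule poly_mapping_eqI)
    (simp add: lookup_sum lookup_single when_def in_keys_iff sum.delta)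

lemma sum_in_ideal:
  assumes "ideal J (mpoly_ring :: ('n::finite, 'k::field) mpoly ring)" "\<And>a. a \<in> A \<Longrightarrow> h a \<in> J"
  shows "sum h A \<in> J"
proof -
  interpret ideal J mpoly_ring by fact
  show ?thesis
    using assms(2)
  proof (induction A rule: infinite_finite_induct)
    case (insert a A)
    then show ?case using a_closed[of "h a" "sum h A"] by simp
  qed (use additive_subgroup.zero_closed[OF is_additive_subgroup] in simp_all)
qed

text \<open>
  A polynomial is the sum of its terms, so an ideal that contains all terms with exponent in \<open>E\<close>
  contains every polynomial supported in \<open>E\<close>.
\<close>

lemma supported_subset_ideal:
  assumes "ideal J (mpoly_ring :: ('n::finite, 'k::field) mpoly ring)"
    and "\<And>e c. e \<in> E \<Longrightarrow> Poly_Mapping.single e c \<in> J"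
  shows "supported E \<subseteq> J"
proof
  fix f assume "f \<in> (supported E :: ('n, 'k) mpoly set)"
  then show "f \<in> J"
    using assms by (subst mpoly_eq_sum_singles) (auto intro!: sum_in_ideal simp: supported_def)
qed

lemma genideal_monomials:
  "Idl\<^bsub>mpoly_ring\<^esub> (monomial ` A :: ('n::finite, 'k::field) mpoly set)
     = supported {e + a |e a. a \<in> A}"
proof
  have "upward_closed {e + a |e a. a \<in> A}"
    using upward_closed_power_exps[of A 1] by simp
  moreover have "monomial ` A \<subseteq> (supported {e + a |e a. a \<in> A} :: ('n, 'k) mpoly set)"
    by (auto simp: monomial_def) (metis add_0)
  ultimately show "Idl\<^bsub>mpoly_ring\<^esub> (monomial ` A :: ('n, 'k) mpoly set)
      \<subseteq> supported {e + a |e a. a \<in> A}"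
    by (intro mpoly.genideal_minimal ideal_supported)
next
  let ?J = "Idl\<^bsub>mpoly_ring\<^esub> (monomial ` A :: ('n, 'k) mpoly set)"
  have J: "ideal ?J mpoly_ring"
    by (rule mpoly.genideal_ideal) simp
  show "supported {e + a |e a. a \<in> A} \<subseteq> ?J"
  proof (rule supported_subset_ideal[OF J])
    fix u and c :: 'k
    assume "u \<in> {e + a |e a. a \<in> A}"
    then obtain e a where u: "u = e + a" "a \<in> A" by blast
    have "monomial a \<in> ?J"
      using mpoly.genideal_self[of "monomial ` A :: ('n, 'k) mpoly set"] u by auto
    then have "Poly_Mapping.single e c * monomial a \<in> ?J"
      using ideal.I_l_closed[OF J, of "monomial a" "Poly_Mapping.single e c"] by simp
    then show "Poly_Mapping.single u c \<in> ?J"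
      by (simp add: u monomial_def mult_single)
  qed
qed

lemma ideal_prod_supported:
  assumes "upward_closed E" "upward_closed F"
  shows "supported E \<cdot>\<^bsub>mpoly_ring\<^esub> supported F
    = (supported {e + d |e d. e \<in> E \<and> d \<in> F} :: ('n::finite, 'k::field) mpoly set)"
    (is "?L = supported ?G")
proof
  show "?L \<subseteq> supported ?G"
  proof
    fix f assume "f \<in> ?L"
    then show "f \<in> supported ?G"
    proof induction
      case (prod i j)
      then show ?case using keys_mult[of i j] by (fastforce simp: supported_def)
    next
      case (sum f g)
      then show ?case using Poly_Mapping.keys_add[of f g] by (auto simp: supported_def)
    qed
  qed
next
  show "supported ?G \<subseteq> ?L"
  proof (rule supported_subset_ideal)
    show "ideal ?L mpoly_ring"
      by (intro mpoly.ideal_prod_is_ideal ideal_supported assms)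
    fix u and c :: 'k
    assume "u \<in> ?G"
    then obtain e d where u: "u = e + d" "e \<in> E" "d \<in> F" by blast
    have "Poly_Mapping.single e c \<otimes>\<^bsub>mpoly_ring\<^esub> Poly_Mapping.single d 1 \<in> ?L"
      using u by (intro ideal_prod.prod) simp_all
    then show "Poly_Mapping.single u c \<in> ?L"
      by (simp add: mult_single u)
  qed
qed

lemma ideal_pow_monomials:
  "ideal_pow (Idl\<^bsub>mpoly_ring\<^esub> (monomial ` A)) k
     = (supported (power_exps A k) :: ('n::finite, 'k::field) mpoly set)"
proof (induction k)
  case 0
  show ?case by (simp add: nat_pow_def ideals_set_def supported_def)
next
  case (Suc k)
  have up: "upward_closed {e + a |e a. a \<in> A}"
    using upward_closed_power_exps[of A 1] by simp
  have "{e + d |e d. e \<in> power_exps A k \<and> d \<in> {e + a |e a. a \<in> A}} = power_exps A (Suc k)"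
  proof (intro equalityI subsetI)
    fix u assume "u \<in> {e + d |e d. e \<in> power_exps A k \<and> d \<in> {e + a |e a. a \<in> A}}"
    then obtain e d a where "u = (e + d) + a" "e \<in> power_exps A k" "a \<in> A"
      by (auto simp: add.assoc)
    moreover from this have "e + d \<in> power_exps A k"
      using upward_closed_power_exps[of A k] by (simp add: upward_closed_def)
    ultimately show "u \<in> power_exps A (Suc k)" by auto
  next
    fix u assume "u \<in> power_exps A (Suc k)"
    then obtain e a where "u = e + (0 + a)" "e \<in> power_exps A k" "a \<in> A" by auto
    then show "u \<in> {e + d |e d. e \<in> power_exps A k \<and> d \<in> {e + a |e a. a \<in> A}}" by blast
  qed
  then show ?case
    using Suc ideal_prod_supported[OF upward_closed_power_exps up, of A k]
    by (simp add: ideals_set_def genideal_monomials del: power_exps.simps)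
qed


section \<open>Associated monomial primes\<close>

abbreviation var_ideal :: "'n::finite set \<Rightarrow> ('n, 'k::field) mpoly set"
  where "var_ideal V \<equiv> Idl\<^bsub>mpoly_ring\<^esub> (variable ` V)"

lemma var_ideal_eq_supported:
  "var_ideal V = (supported {w. Poly_Mapping.keys w \<inter> V \<noteq> {}} :: ('n::finite, 'k::field) mpoly set)"
proof -
  have "{e + a |e a. a \<in> (\<lambda>i. Poly_Mapping.single i 1) ` V}
      = {w :: 'n \<Rightarrow>\<^sub>0 nat. Poly_Mapping.keys w \<inter> V \<noteq> {}}"
  proof (intro equalityI subsetI)
    fix w :: "'n \<Rightarrow>\<^sub>0 nat"
    assume "w \<in> {e + a |e a. a \<in> (\<lambda>i. Poly_Mapping.single i 1) ` V}"
    then obtain e i where "w = e + Poly_Mapping.single i 1" "i \<in> V" by blast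
    then have "i \<in> Poly_Mapping.keys w" by (simp add: in_keys_iff lookup_add)
    then show "w \<in> {w. Poly_Mapping.keys w \<inter> V \<noteq> {}}" using \<open>i \<in> V\<close> by blast
  next
    fix w :: "'n \<Rightarrow>\<^sub>0 nat"
    assume "w \<in> {w. Poly_Mapping.keys w \<inter> V \<noteq> {}}"
    then obtain i where i: "Poly_Mapping.lookup w i \<noteq> 0" "i \<in> V" by (auto simp: in_keys_iff)
    then have "w = (w - Poly_Mapping.single i 1) + Poly_Mapping.single i 1"
      by (intro poly_mapping_eqI) (auto simp: lookup_add lookup_minus lookup_single when_def)
    then show "w \<in> {e + a |e a. a \<in> (\<lambda>i. Poly_Mapping.single i 1) ` V}" using i by blast
  qed
  moreover have "variable ` V = (monomial ` (\<lambda>i. Poly_Mapping.single i 1) ` V :: ('n, 'k) mpoly set)"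
    by (simp add: image_image variable_def)
  ultimately show ?thesis by (simp add: genideal_monomials)
qed

text \<open>
  The exponents have to be ordered compatibly with addition, but the variables carry no
  order. Numbering them embeds the exponents into those over \<^typ>\<open>nat\<close>, which are ordered
  lexicographically.
\<close>

lemma ex_additive_embedding_in_ordered:
  "\<exists>\<phi> :: ('n::finite \<Rightarrow>\<^sub>0 nat) \<Rightarrow> (nat \<Rightarrow>\<^sub>0 nat). inj \<phi> \<and> (\<forall>a b. \<phi> (a + b) = \<phi> a + \<phi> b)"
proof -
  obtain \<iota> :: "'n \<Rightarrow> nat" where \<iota>: "inj \<iota>"
    using finite_imp_inj_to_nat_seg[of "UNIV :: 'n set"] by auto
  define \<phi> where "\<phi> m = (\<Sum>i\<in>UNIV. Poly_Mapping.single (\<iota> i) (Poly_Mapping.lookup m i))"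
    for m :: "'n \<Rightarrow>\<^sub>0 nat"
  have "Poly_Mapping.lookup (\<phi> m) (\<iota> i) = Poly_Mapping.lookup m i" for m i
    by (simp add: \<phi>_def lookup_sum lookup_single when_def inj_eq[OF \<iota>])
  then have "inj \<phi>"
    by (intro injI poly_mapping_eqI) metis
  moreover have "\<phi> (a + b) = \<phi> a + \<phi> b" for a b
    by (simp add: \<phi>_def lookup_add single_add sum.distrib)
  ultimately show ?thesis by blast
qed

text \<open>
  A leading term argument modulo the ideal: a polynomial outside \<open>(V)\<close> has terms free of \<open>V\<close>.
  Multiplying the greatest such term of \<open>f\<close> with that of \<open>g\<close> gives a term free of \<open>V\<close> that no other
  pair of terms can cancel.
\<close>

lemma primeideal_var_ideal:
  "primeideal (var_ideal V :: ('n::finite, 'k::field) mpoly set) mpoly_ring"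
proof (rule primeidealI)
  define free where "free = {w :: 'n \<Rightarrow>\<^sub>0 nat. Poly_Mapping.keys w \<inter> V = {}}"
  have P: "f \<in> var_ideal V \<longleftrightarrow> Poly_Mapping.keys f \<inter> free = {}" for f :: "('n, 'k) mpoly"
    by (auto simp: var_ideal_eq_supported supported_def free_def)
  show "ideal (var_ideal V :: ('n, 'k) mpoly set) mpoly_ring"
    by (rule mpoly.genideal_ideal) simp
  show "cring (mpoly_ring :: ('n, 'k) mpoly ring)" by (rule mpoly.is_cring)
  have "1 \<notin> (var_ideal V :: ('n, 'k) mpoly set)" by (simp add: P free_def)
  then show "carrier mpoly_ring \<noteq> (var_ideal V :: ('n, 'k) mpoly set)" by auto
  have "f * g \<notin> var_ideal V" if fg: "f \<notin> var_ideal V" "g \<notin> var_ideal V"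
    for f g :: "('n, 'k) mpoly"
  proof -
    obtain \<phi> :: "('n \<Rightarrow>\<^sub>0 nat) \<Rightarrow> (nat \<Rightarrow>\<^sub>0 nat)"
      where inj: "inj \<phi>" and add: "\<And>a b. \<phi> (a + b) = \<phi> a + \<phi> b"
      using ex_additive_embedding_in_ordered by blast
    have lead: "\<exists>a \<in> Poly_Mapping.keys h \<inter> free.
        \<forall>l \<in> Poly_Mapping.keys h \<inter> free. \<phi> l \<le> \<phi> a" if "h \<notin> var_ideal V" for h :: "('n, 'k) mpoly"
    proof -
      have "finite (\<phi> ` (Poly_Mapping.keys h \<inter> free))" "\<phi> ` (Poly_Mapping.keys h \<inter> free) \<noteq> {}"
        using that by (auto simp: P)
      from Max_in[OF this] Max_ge[OF this(1)] show ?thesis by fastforce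
    qed
    obtain a where a: "a \<in> Poly_Mapping.keys f" "a \<in> free"
      "\<And>l. l \<in> Poly_Mapping.keys f \<Longrightarrow> l \<in> free \<Longrightarrow> \<phi> l \<le> \<phi> a"
      using lead[OF fg(1)] by auto
    obtain b where b: "b \<in> Poly_Mapping.keys g" "b \<in> free"
      "\<And>q. q \<in> Poly_Mapping.keys g \<Longrightarrow> q \<in> free \<Longrightarrow> \<phi> q \<le> \<phi> b"
      using lead[OF fg(2)] by auto
    have free_add: "l + q \<in> free \<longleftrightarrow> l \<in> free \<and> q \<in> free" for l q
      by (auto simp: free_def in_keys_iff lookup_add disjoint_iff)
    have ab: "a + b \<in> free" using a b by (simp add: free_add)
    \<comment> \<open>Both factors of a monomial free of \<open>V\<close> are free of \<open>V\<close>, so the maximality of \<open>a\<close> and \<open>b\<close>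
      applies to them.\<close>
    have only: "l = a \<and> q = b"
      if "l \<in> Poly_Mapping.keys f" "q \<in> Poly_Mapping.keys g" "a + b = l + q" for l q
    proof -
      have "l \<in> free" "q \<in> free" using ab that(3) by (simp_all add: free_add)
      then have le: "\<phi> l \<le> \<phi> a" "\<phi> q \<le> \<phi> b" using a(3) b(3) that by auto
      have "\<phi> l + \<phi> q = \<phi> a + \<phi> b" using that(3) add by metis
      then have "\<phi> l = \<phi> a"
        using le by (metis add_less_le_mono less_le)
      then have "l = a" by (rule injD[OF inj])
      then show ?thesis using that(3) by simp
    qed
    have "Poly_Mapping.lookup (f * g) (a + b) =
        Sum_any (\<lambda>l. Poly_Mapping.lookup f l *
          Sum_any (\<lambda>q. Poly_Mapping.lookup g q when a + b = l + q))"
      by (rule lookup_mult)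
    also have "\<dots> = Sum_any (\<lambda>l. Poly_Mapping.lookup f a * Poly_Mapping.lookup g b when l = a)"
    proof (rule Sum_any.cong)
      fix l
      have "Sum_any (\<lambda>q. Poly_Mapping.lookup g q when a + b = l + q) = (Poly_Mapping.lookup g b when l = a)"
        if "l \<in> Poly_Mapping.keys f"
      proof -
        have "(Poly_Mapping.lookup g q when a + b = l + q)
            = ((Poly_Mapping.lookup g b when l = a) when q = b)" for q
          using only[OF that, of q] by (auto simp: when_def in_keys_iff)
        then show ?thesis by simp
      qed
      then show "Poly_Mapping.lookup f l * Sum_any (\<lambda>q. Poly_Mapping.lookup g q when a + b = l + q)
          = (Poly_Mapping.lookup f a * Poly_Mapping.lookup g b when l = a)"
        using a(1) by (cases "l \<in> Poly_Mapping.keys f") (auto simp: when_def in_keys_iff)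
    qed
    also have "\<dots> = Poly_Mapping.lookup f a * Poly_Mapping.lookup g b" by simp
    also have "\<dots> \<noteq> 0" using a(1) b(1) by (simp add: in_keys_iff)
    finally have "a + b \<in> Poly_Mapping.keys (f * g)" by (simp add: in_keys_iff)
    then show ?thesis using ab by (auto simp: P)
  qed
  then show "f \<in> var_ideal V \<or> g \<in> var_ideal V"
    if "f \<otimes>\<^bsub>mpoly_ring\<^esub> g \<in> var_ideal V" for f g :: "('n, 'k) mpoly"
    using that by auto
qed

lemma lookup_mult_monomial:
  fixes f :: "('n::finite, 'k::field) mpoly"
  shows "Poly_Mapping.lookup (f * monomial u) (w + u) = Poly_Mapping.lookup f w"
proof -
  have "Poly_Mapping.lookup (f * monomial u) (w + u)
      = Sum_any (\<lambda>l. Poly_Mapping.lookup f l * Sum_any (\<lambda>q. (1 when u = q) when w + u = l + q))"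
    by (simp add: lookup_mult monomial_def lookup_single)
  also have "\<dots> = Sum_any (\<lambda>l. Poly_Mapping.lookup f w when l = w)"
  proof (rule Sum_any.cong)
    fix l
    have "((1 when u = q) when w + u = l + q) = ((1::'k) when l = w when u = q)" for q
      by (auto simp: when_def)
    then have "Sum_any (\<lambda>q. (1 when u = q) when w + u = l + q) = ((1::'k) when l = w)" by simp
    then show "Poly_Mapping.lookup f l * Sum_any (\<lambda>q. (1 when u = q) when w + u = l + q)
        = (Poly_Mapping.lookup f w when l = w)"
      by (simp add: when_def)
  qed
  finally show ?thesis by simp
qed

lemma keys_mult_monomial:
  fixes f :: "('n::finite, 'k::field) mpoly"
  shows "Poly_Mapping.keys (f * monomial u) = (\<lambda>w. w + u) ` Poly_Mapping.keys f"
proof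
  show "Poly_Mapping.keys (f * monomial u) \<subseteq> (\<lambda>w. w + u) ` Poly_Mapping.keys f"
    using keys_mult[of f "monomial u"] by (auto simp: monomial_def)
  show "(\<lambda>w. w + u) ` Poly_Mapping.keys f \<subseteq> Poly_Mapping.keys (f * monomial u)"
    by (auto simp: in_keys_iff lookup_mult_monomial)
qed

text \<open>
  Multiplication by a monomial shifts all exponents, so the hypothesis says precisely that
  \<open>(V)\<close> is the colon ideal of the monomial \<open>u\<close>.
\<close>

lemma var_ideal_in_Ass:
  assumes "\<And>w. w + u \<in> E \<longleftrightarrow> Poly_Mapping.keys w \<inter> V \<noteq> {}"
  shows "var_ideal V \<in> Ass mpoly_ring (supported E :: ('n::finite, 'k::field) mpoly set)"
proof -
  have "var_ideal V = colon mpoly_ring (supported E) (monomial u :: ('n, 'k) mpoly)"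
    using assms
    by (auto simp: var_ideal_eq_supported colon_def supported_def keys_mult_monomial)
  moreover have "primeideal (var_ideal V :: ('n, 'k) mpoly set) mpoly_ring"
    by (rule primeideal_var_ideal)
  ultimately show ?thesis by (auto simp: Ass_def)
qed

text \<open>
  If \<open>(V)\<close> is the colon ideal of a polynomial \<open>v\<close>, then any term of \<open>v\<close> outside the ideal serves as
  \<open>u\<close>: multiplying \<open>v\<close> by a variable cannot make terms cancel, so each term of the product lies in
  the ideal.
\<close>

lemma var_ideal_in_Ass_imp_corner:
  assumes "var_ideal V \<in> Ass mpoly_ring (supported E :: ('n::finite, 'k::field) mpoly set)"
  obtains u where "u \<notin> E" "\<And>i. i \<in> V \<Longrightarrow> u + Poly_Mapping.single i 1 \<in> E"
proof -
  from assms obtain v :: "('n, 'k) mpoly"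
    where v: "var_ideal V = colon mpoly_ring (supported E) v" by (auto simp: Ass_def)
  have "1 \<notin> (var_ideal V :: ('n, 'k) mpoly set)"
    by (simp add: var_ideal_eq_supported supported_def)
  then have "v \<notin> supported E" by (auto simp: v colon_def)
  then obtain u where u: "u \<in> Poly_Mapping.keys v" "u \<notin> E" by (auto simp: supported_def)
  show thesis
  proof (rule that[OF u(2)])
    fix i assume "i \<in> V"
    then have "variable i \<in> (var_ideal V :: ('n, 'k) mpoly set)"
      by (subst var_ideal_eq_supported) (simp add: variable_def monomial_def)
    then have "v * variable i \<in> supported E" by (simp add: v colon_def mult.commute)
    then show "u + Poly_Mapping.single i 1 \<in> E"
      using u(1) by (auto simp: supported_def variable_def keys_mult_monomial)
  qed
qed


section \<open>Ideals generated by monomials in three variables\<close>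

definition xyz :: "'n \<Rightarrow> 'n \<Rightarrow> 'n \<Rightarrow> nat \<times> nat \<times> nat \<Rightarrow> ('n::finite \<Rightarrow>\<^sub>0 nat)"
  where "xyz x y z = (\<lambda>(a, b, c).
    Poly_Mapping.single x a + Poly_Mapping.single y b + Poly_Mapping.single z c)"

text \<open>
  Whether \<open>x^a y^b z^c\<close> lies in the \<open>k\<close>-th power of the ideal generated by the monomials in \<open>G\<close>,
  decided by splitting off one generator at a time.
\<close>

fun power_contains :: "(nat \<times> nat \<times> nat) set \<Rightarrow> nat \<Rightarrow> nat \<Rightarrow> nat \<Rightarrow> nat \<Rightarrow> bool"
  where
    "power_contains G 0 a b c \<longleftrightarrow> True"
  | "power_contains G (Suc k) a b c \<longleftrightarrow>
      (\<exists>(p, q, r) \<in> G. p \<le> a \<and> q \<le> b \<and> r \<le> c \<and> power_contains G k (a - p) (b - q) (c - r))"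

lemma lookup_xyz:
  assumes "distinct [x, y, z]"
  shows "Poly_Mapping.lookup (xyz x y z (a, b, c)) i =
    (if i = x then a else if i = y then b else if i = z then c else 0)"
  using assms by (auto simp: xyz_def lookup_add lookup_single when_def)

text \<open>
  Membership of a monomial ignores all variables other than \<open>x\<close>, \<open>y\<close>, \<open>z\<close>; this reduces any number
  of variables to three.
\<close>

lemma in_power_exps_xyz_iff:
  assumes "distinct [x, y, z]"
  shows "u \<in> power_exps (xyz x y z ` G) k \<longleftrightarrow>
    power_contains G k (Poly_Mapping.lookup u x) (Poly_Mapping.lookup u y) (Poly_Mapping.lookup u z)"
proof (induction k arbitrary: u)
  case 0
  show ?case by simp
next
  case (Suc k)
  show ?case
  proof
    assume "u \<in> power_exps (xyz x y z ` G) (Suc k)"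
    then obtain e p q r where u: "u = e + xyz x y z (p, q, r)" "(p, q, r) \<in> G"
      "e \<in> power_exps (xyz x y z ` G) k" by auto
    then show "power_contains G (Suc k) (Poly_Mapping.lookup u x) (Poly_Mapping.lookup u y)
        (Poly_Mapping.lookup u z)"
      using Suc[of e] assms
      by (auto simp: lookup_add lookup_xyz intro!: bexI[of _ "(p, q, r)"])
  next
    assume "power_contains G (Suc k) (Poly_Mapping.lookup u x) (Poly_Mapping.lookup u y)
        (Poly_Mapping.lookup u z)"
    then obtain p q r where g: "(p, q, r) \<in> G"
      "p \<le> Poly_Mapping.lookup u x" "q \<le> Poly_Mapping.lookup u y" "r \<le> Poly_Mapping.lookup u z"
      "power_contains G k (Poly_Mapping.lookup u x - p) (Poly_Mapping.lookup u y - q)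
        (Poly_Mapping.lookup u z - r)"
      by auto
    define e where "e = u - xyz x y z (p, q, r)"
    have "u = e + xyz x y z (p, q, r)"
      using g(2-4) assms
      by (intro poly_mapping_eqI) (simp add: e_def lookup_add lookup_minus lookup_xyz)
    moreover have "e \<in> power_exps (xyz x y z ` G) k"
      using g(5) assms by (auto simp: Suc e_def lookup_minus lookup_xyz)
    ultimately show "u \<in> power_exps (xyz x y z ` G) (Suc k)"
      using g(1) by auto
  qed
qed


section \<open>The fluctuating family\<close>

definition gens :: "nat \<Rightarrow> (nat \<times> nat \<times> nat) set"
  where "gens t = {(0, 6, 0), (1, 5, 0), (4, 2, 0), (5, 1, 0), (6, 0, t)}"

text \<open>
  Both bounds are additive over products of generators. The second weight \<open>b * t + c\<close> is the one
  that gives \<open>x^5 y\<close> and \<open>x^6 z^t\<close> the same value \<open>t\<close>, and all other generators at least \<open>t\<close>.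
\<close>

lemma power_contains_gens_weight:
  "power_contains (gens t) k a b c \<Longrightarrow> 6 * k \<le> a + b \<and> k * t \<le> b * t + c"
proof (induction k arbitrary: a b c)
  case 0
  show ?case by simp
next
  case (Suc k)
  then obtain p q r where g: "(p, q, r) \<in> gens t" "p \<le> a" "q \<le> b" "r \<le> c"
    "power_contains (gens t) k (a - p) (b - q) (c - r)" by auto
  have "6 * k \<le> (a - p) + (b - q) \<and> k * t \<le> (b - q) * t + (c - r)"
    by (rule Suc.IH[OF g(5)])
  moreover have "p + q = 6" "t \<le> q * t + r" using g(1) by (auto simp: gens_def)
  moreover have "(b - q) * t + q * t = b * t"
    using g(3) by (metis add_mult_distrib le_add_diff_inverse2)
  moreover have "6 * Suc k = 6 * k + 6" "Suc k * t = k * t + t" by simp_all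
  ultimately show ?case using g(2-4) by linarith
qed

lemma power_contains_gens_1: "power_contains (gens t) 1 a b c \<longleftrightarrow>
    6 \<le> b \<or> 1 \<le> a \<and> 5 \<le> b \<or> 4 \<le> a \<and> 2 \<le> b \<or> 5 \<le> a \<and> 1 \<le> b \<or> 6 \<le> a \<and> t \<le> c"
  by (auto simp: gens_def)

lemma power_contains_SucI:
  "(p, q, r) \<in> G \<Longrightarrow> power_contains G k a b c \<Longrightarrow> power_contains G (Suc k) (p + a) (q + b) (r + c)"
  by (auto intro!: bexI[of _ "(p, q, r)"])

lemma power_contains_mono:
  "power_contains G k a b c \<Longrightarrow> a \<le> a' \<Longrightarrow> b \<le> b' \<Longrightarrow> c \<le> c' \<Longrightarrow> power_contains G k a' b' c'"
proof (induction k arbitrary: a b c a' b' c')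
  case 0
  show ?case by simp
next
  case (Suc k)
  then obtain p q r where g: "(p, q, r) \<in> G" "p \<le> a" "q \<le> b" "r \<le> c"
    "power_contains G k (a - p) (b - q) (c - r)" by auto
  have "power_contains G k (a' - p) (b' - q) (c' - r)"
    by (rule Suc.IH[OF g(5)]) (use Suc.prems in \<open>simp_all add: diff_le_mono\<close>)
  then show ?case using g Suc.prems by (auto intro!: bexI[of _ "(p, q, r)"])
qed

lemma power_contains_3I:
  assumes "(p1, q1, r1) \<in> G" "(p2, q2, r2) \<in> G" "(p3, q3, r3) \<in> G"
    and "p1 + p2 + p3 \<le> a" "q1 + q2 + q3 \<le> b" "r1 + r2 + r3 \<le> c"
  shows "power_contains G 3 a b c"
proof -
  have "power_contains G (Suc (Suc (Suc 0)))
      (p1 + (p2 + (p3 + 0))) (q1 + (q2 + (q3 + 0))) (r1 + (r2 + (r3 + 0)))"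
    using assms(1-3) by (intro power_contains_SucI) simp_all
  then show ?thesis
    unfolding numeral_3_eq_3 by (rule power_contains_mono) (use assms(4-6) in simp_all)
qed

text \<open>Hence the \<open>x\<close>-exponents of the generators free of \<open>z\<close> have no gap in the third power.\<close>

lemma sum_of_three_0145:
  fixes s :: nat
  assumes "s \<le> 15"
  obtains s1 s2 s3 where "s1 \<in> {0, 1, 4, 5}" "s2 \<in> {0, 1, 4, 5}" "s3 \<in> {0, 1, 4, 5}"
    "s = s1 + s2 + s3"
proof -
  have "\<forall>s\<in>{..15::nat}. \<exists>s1\<in>{0, 1, 4, 5}. \<exists>s2\<in>{0, 1, 4, 5}. \<exists>s3\<in>{0, 1, 4, 5}. s = s1 + s2 + s3"
    by code_simp
  then show thesis using that assms by blast
qed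

text \<open>
  The two necessary inequalities are sufficient. If \<open>b \<ge> 3\<close>, then three generators free of \<open>z\<close>
  divide the monomial; otherwise a product of \<open>b\<close> factors \<open>x^5 y\<close> and \<open>3 - b\<close> factors \<open>x^6 z^t\<close>
  does.
\<close>

lemma power_contains_gens_3:
  "power_contains (gens t) 3 a b c \<longleftrightarrow> 18 \<le> a + b \<and> 3 * t \<le> b * t + c"
proof
  assume "power_contains (gens t) 3 a b c"
  then show "18 \<le> a + b \<and> 3 * t \<le> b * t + c" using power_contains_gens_weight[of t 3 a b c] by simp
next
  assume *: "18 \<le> a + b \<and> 3 * t \<le> b * t + c"
  have z: "(6, 0, t) \<in> gens t" and xy: "(5, 1, 0) \<in> gens t" by (simp_all add: gens_def)
  consider "b = 0" | "b = 1" | "b = 2" | "3 \<le> b" by linarith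
  then show "power_contains (gens t) 3 a b c"
  proof cases
    case 1
    then show ?thesis using * by (intro power_contains_3I[OF z z z]) simp_all
  next
    case 2
    then show ?thesis using * by (intro power_contains_3I[OF z z xy]) simp_all
  next
    case 3
    then show ?thesis using * by (intro power_contains_3I[OF z xy xy]) simp_all
  next
    case 4
    \<comment> \<open>The largest \<open>x\<close>-exponent of a product of three generators free of \<open>z\<close> that still divides
      \<open>x^a\<close> leaves the least \<open>y\<close>-exponent.\<close>
    obtain s1 s2 s3 where s: "s1 \<in> {0, 1, 4, 5}" "s2 \<in> {0, 1, 4, 5}" "s3 \<in> {0, 1, 4, 5}"
      "min a 15 = s1 + s2 + s3"
      using sum_of_three_0145[of "min a 15"] by auto
    have "(i, 6 - i, 0) \<in> gens t \<and> i \<le> 6" if "i \<in> {0, 1, 4, 5}" for i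
      using that by (auto simp: gens_def)
    note g = this[OF s(1)] this[OF s(2)] this[OF s(3)]
    show ?thesis
      by (rule power_contains_3I[OF conjunct1[OF g(1)] conjunct1[OF g(2)] conjunct1[OF g(3)]])
        (use g s(4) * 4 in linarith)+
  qed
qed

text \<open>
  The gap at \<open>x\<close>-exponent 7 in the square. It is closed by \<open>x\<close> through \<open>(x^4 y^2)^2\<close>, by \<open>y\<close>
  through \<open>(x^5 y) (x y^5)\<close> and by \<open>z\<close> through \<open>(x^6 z^t) (x y^5)\<close>.
\<close>

lemma power_contains_gens_2:
  assumes "0 < t"
  shows "power_contains (gens t) 2 (i + 7) (j + 5) (l + (t - 1)) \<longleftrightarrow> 0 < i \<or> 0 < j \<or> 0 < l"
proof
  show "0 < i \<or> 0 < j \<or> 0 < l" if "power_contains (gens t) 2 (i + 7) (j + 5) (l + (t - 1))"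
  proof (rule ccontr)
    assume "\<not> ?thesis"
    then show False using that assms by (auto simp: gens_def numeral_2_eq_2)
  qed
next
  have "power_contains (gens t) 2 8 5 0" "power_contains (gens t) 2 7 6 0"
    "power_contains (gens t) 2 7 5 t"
    by (simp_all add: gens_def numeral_2_eq_2)
  note this[THEN power_contains_mono]
  then show "power_contains (gens t) 2 (i + 7) (j + 5) (l + (t - 1))" if "0 < i \<or> 0 < j \<or> 0 < l"
    using that assms by auto
qed

definition fluct_ideal :: "'n \<Rightarrow> 'n \<Rightarrow> 'n \<Rightarrow> nat \<Rightarrow> ('n::finite, 'k::field) mpoly set"
  where "fluct_ideal x y z t = Idl\<^bsub>mpoly_ring\<^esub> (monomial ` xyz x y z ` gens t)"

lemma fluct_ideal_pow:
  "ideal_pow (fluct_ideal x y z t) k = supported (power_exps (xyz x y z ` gens t) k)"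
  by (simp add: fluct_ideal_def ideal_pow_monomials)

lemma xyz_prime_notin_Ass_fluct_ideal_pow:
  assumes "distinct [x, y, z]" "k = 1 \<or> k = 3"
  shows "var_ideal {x, y, z} \<notin> Ass mpoly_ring
    (ideal_pow (fluct_ideal x y z t :: ('n::finite, 'k::field) mpoly set) k)"
proof
  assume "var_ideal {x, y, z} \<in> Ass mpoly_ring
    (ideal_pow (fluct_ideal x y z t :: ('n, 'k) mpoly set) k)"
  then obtain u where u: "u \<notin> power_exps (xyz x y z ` gens t) k"
    "\<And>i. i \<in> {x, y, z} \<Longrightarrow> u + Poly_Mapping.single i 1 \<in> power_exps (xyz x y z ` gens t) k"
    unfolding fluct_ideal_pow by (rule var_ideal_in_Ass_imp_corner) blast
  define a b c where "a = Poly_Mapping.lookup u x" "b = Poly_Mapping.lookup u y"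
    "c = Poly_Mapping.lookup u z"
  have no: "\<not> power_contains (gens t) k a b c"
    using u(1) assms by (simp add: in_power_exps_xyz_iff a_b_c_def)
  have "x \<noteq> y" "y \<noteq> x" "x \<noteq> z" "z \<noteq> x" "y \<noteq> z" "z \<noteq> y" using assms(1) by auto
  then have "power_contains (gens t) k (a + 1) b c" "power_contains (gens t) k a (b + 1) c"
    "power_contains (gens t) k a b (c + 1)"
    using u(2)[of x] u(2)[of y] u(2)[of z] assms(1)
    by (simp_all add: in_power_exps_xyz_iff a_b_c_def lookup_add lookup_single)
  note corner = no this
  from assms(2) show False
  proof
    assume "k = 1"
    with corner show False unfolding \<open>k = 1\<close> power_contains_gens_1 by linarith
  next
    assume "k = 3"
    \<comment> \<open>The two inequalities that describe the cube bound \<open>a + b\<close>, which a step along \<open>z\<close> leaves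
      unchanged, and \<open>b * t + c\<close>, which a step along \<open>x\<close> leaves unchanged.\<close>
    with corner show False unfolding \<open>k = 3\<close> power_contains_gens_3 by simp
  qed
qed

lemma xyz_prime_in_Ass_fluct_ideal_pow_2:
  assumes "distinct [x, y, z]" "0 < t"
  shows "var_ideal {x, y, z} \<in> Ass mpoly_ring
    (ideal_pow (fluct_ideal x y z t :: ('n::finite, 'k::field) mpoly set) 2)"
  unfolding fluct_ideal_pow
proof (rule var_ideal_in_Ass[of "xyz x y z (7, 5, t - 1)"])
  fix w :: "'n \<Rightarrow>\<^sub>0 nat"
  show "w + xyz x y z (7, 5, t - 1) \<in> power_exps (xyz x y z ` gens t) 2 \<longleftrightarrow>
      Poly_Mapping.keys w \<inter> {x, y, z} \<noteq> {}"
    using assms power_contains_gens_2[OF assms(2)]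
    by (auto simp: in_power_exps_xyz_iff lookup_add lookup_xyz in_keys_iff disjoint_iff)
qed

lemma has_fluctuation_fluct_ideal:
  assumes "distinct [x, y, z]" "0 < t"
  shows "has_fluctuation (fluct_ideal x y z t :: ('n::finite, 'k::field) mpoly set)"
proof -
  have "monomial_prime (var_ideal {x, y, z} :: ('n, 'k) mpoly set)"
    unfolding monomial_prime_def by blast
  moreover have "(0::nat) < 1" "(1::nat) < 2" "(2::nat) < 3" by simp_all
  ultimately show ?thesis
    unfolding has_fluctuation_def
    using xyz_prime_notin_Ass_fluct_ideal_pow[OF assms(1)] xyz_prime_in_Ass_fluct_ideal_pow_2[OF assms]
    by metis
qed

text \<open>The exponent \<open>t\<close> can be read off as the least \<open>r\<close> for which \<open>x^6 z^r\<close> lies in the ideal.\<close>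

lemma inj_fluct_ideal:
  assumes "distinct [x, y, z]"
  shows "inj (fluct_ideal x y z :: nat \<Rightarrow> ('n::finite, 'k::field) mpoly set)"
proof (rule injI)
  fix s t
  assume eq: "fluct_ideal x y z s = (fluct_ideal x y z t :: ('n, 'k) mpoly set)"
  have "monomial (xyz x y z (6, 0, r)) \<in> (fluct_ideal x y z t :: ('n, 'k) mpoly set) \<longleftrightarrow> t \<le> r" for r t
  proof -
    have "fluct_ideal x y z t = (supported (power_exps (xyz x y z ` gens t) 1) :: ('n, 'k) mpoly set)"
      by (simp add: fluct_ideal_def genideal_monomials)
    then show ?thesis
      using assms power_contains_gens_1[of t 6 0 r]
      by (auto simp: monomial_def in_power_exps_xyz_iff lookup_xyz
          simp del: power_exps.simps power_contains.simps)
  qed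
  then show "s = t" using eq by (metis order_antisym order_refl)
qed

theorem theorem5p8:
  assumes "card (UNIV :: 'n::finite set) \<ge> 3"
  shows "infinite {I :: ('n, 'k::field) mpoly set. monomial_ideal I \<and> has_fluctuation I}"
proof -
  obtain x y z :: 'n where d: "distinct [x, y, z]"
  proof -
    obtain T :: "'n set" where "card T = 3" using obtain_subset_with_card_n[OF assms] by blast
    then show thesis using that by (auto simp: card_3_iff)
  qed
  \<comment> \<open>The shift to \<open>Suc t\<close> excludes \<open>t = 0\<close>, for which no generator involves \<open>z\<close>.\<close>
  have "inj (\<lambda>t. fluct_ideal x y z (Suc t) :: ('n, 'k) mpoly set)"
    using inj_fluct_ideal[OF d] by (auto intro!: injI dest: injD)
  then have "infinite (range (\<lambda>t. fluct_ideal x y z (Suc t) :: ('n, 'k) mpoly set))"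
    by (rule range_inj_infinite)
  moreover have "range (\<lambda>t. fluct_ideal x y z (Suc t) :: ('n, 'k) mpoly set)
      \<subseteq> {I. monomial_ideal I \<and> has_fluctuation I}"
    using has_fluctuation_fluct_ideal[OF d]
    by (auto simp: monomial_ideal_def fluct_ideal_def)
  ultimately show ?thesis using infinite_super by blast
qed

end
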